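(* For any odd integer $n\geq 1$ we have $$\sum_{j=1}^n(-1)^{j+1}\left\lfloor\sqrt{jn}\right\rfloor=\frac{n+1}{2}.$$
   Context: For $x\in\mathbb{R}$, $\lfloor x\rfloor$ denotes the floor function, i.e. the integer defined by $\lfloor x\rfloor\leq x<\lfloor x\rfloor+1$. *)

theory Defs
  imports Complex_Main
begin

end

theory Submission
  imports Defs
begin

text \<open>
  Write \<open>\<lfloor>sqrt (j n)\<rfloor>\<close> as the number of \<open>k\<close> in \<open>{1..n}\<close> with \<open>k\<^sup>2 \<le> j n\<close>, that is with
  \<open>\<lceil>k\<^sup>2 / n\<rceil> \<le> j\<close>, and exchange the two summations. For odd \<open>n\<close> the inner alternating sum over
  \<open>j \<in> {\<lceil>k\<^sup>2 / n\<rceil>..n}\<close> is \<open>1\<close> or \<open>0\<close> according to the parity of \<open>\<lceil>k\<^sup>2 / n\<rceil>\<close>. Since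
  \<open>(n - k)\<^sup>2 / n = n - 2 k + k\<^sup>2 / n\<close>, this parity differs for \<open>k\<close> and \<open>n - k\<close>, so exactly half
  of the \<open>k < n\<close> contribute, and so does \<open>k = n\<close>.
\<close>

text \<open>Adding \<open>n - 1\<close> before the truncating division rounds up; the value stays in
  \<open>nat\<close>, so it can serve as an exponent and a summation bound.\<close>

definition ceil_sq_div :: "nat \<Rightarrow> nat \<Rightarrow> nat" where
  "ceil_sq_div n k = (k\<^sup>2 + n - 1) div n"

lemma ceil_sq_div_le_iff:
  assumes "n \<ge> 1"
  shows "ceil_sq_div n k \<le> j \<longleftrightarrow> k\<^sup>2 \<le> j * n"
proof -
  have "ceil_sq_div n k \<le> j \<longleftrightarrow> (k\<^sup>2 + n - 1) div n < Suc j"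
    by (auto simp: ceil_sq_div_def)
  also have "\<dots> \<longleftrightarrow> k\<^sup>2 + n - 1 < Suc j * n"
    using assms by (simp only: div_less_iff_less_mult)
  also have "\<dots> \<longleftrightarrow> k\<^sup>2 \<le> j * n"
    using assms by auto
  finally show ?thesis .
qed

lemma ceil_sq_div_self:
  assumes "n \<ge> 1"
  shows "ceil_sq_div n n = n"
proof (rule antisym)
  show "ceil_sq_div n n \<le> n"
    using assms by (simp add: ceil_sq_div_le_iff power2_eq_square)
  have "n * n \<le> ceil_sq_div n n * n"
    using ceil_sq_div_le_iff[OF assms, of n "ceil_sq_div n n"] by (simp add: power2_eq_square)
  then show "n \<le> ceil_sq_div n n"
    using assms by simp
qed

text \<open>Expanding the square changes the numerator by multiples of \<open>n\<close>, which pass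
  through \<open>div\<close>. Both sides are sums to avoid truncated subtraction.\<close>

lemma ceil_sq_div_diff:
  assumes "n \<ge> 1" and "k \<le> n"
  shows "ceil_sq_div n (n - k) + 2 * k = n + ceil_sq_div n k"
proof -
  have "(n - k)\<^sup>2 + n * (2 * k) = k\<^sup>2 + n * n"
  proof -
    obtain d where "n = k + d" using assms(2) le_Suc_ex by blast
    then show ?thesis by (simp add: power2_eq_square algebra_simps)
  qed
  then have "(n - k)\<^sup>2 + n - 1 + n * (2 * k) = k\<^sup>2 + n - 1 + n * n"
    using assms(1) by linarith
  then have "((n - k)\<^sup>2 + n - 1 + n * (2 * k)) div n = (k\<^sup>2 + n - 1 + n * n) div n"
    by (rule arg_cong)
  moreover have "(a + n * b) div n = b + a div n" for a b
    using assms(1) by simp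
  ultimately show ?thesis
    by (metis ceil_sq_div_def add.commute)
qed

text \<open>The \<open>k\<close> counted form an initial segment \<open>{1..m}\<close>;
  \<open>j \<le> n\<close> gives \<open>m \<le> n\<close>, so the bound \<open>n\<close> cuts
  nothing off.\<close>

lemma floor_sqrt_mult_eq_card:
  fixes j n :: nat
  assumes "j \<le> n"
  shows "\<lfloor>sqrt (real j * real n)\<rfloor> = int (card {k \<in> {1..n}. k\<^sup>2 \<le> j * n})"
proof -
  define m where "m = nat \<lfloor>sqrt (real j * real n)\<rfloor>"
  have le_m: "k \<le> m \<longleftrightarrow> k\<^sup>2 \<le> j * n" for k
  proof -
    have "k \<le> m \<longleftrightarrow> real k \<le> sqrt (real (j * n))"
      unfolding m_def by (simp add: le_nat_iff le_floor_iff)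
    also have "\<dots> \<longleftrightarrow> (real k)\<^sup>2 \<le> real (j * n)"
      by (metis of_nat_0_le_iff real_le_rsqrt real_sqrt_le_mono real_sqrt_pow2 power_mono)
    also have "\<dots> \<longleftrightarrow> k\<^sup>2 \<le> j * n"
      by (metis of_nat_le_iff of_nat_power)
    finally show ?thesis .
  qed
  have "m\<^sup>2 \<le> n\<^sup>2"
    using le_m[of m] mult_le_mono1[OF assms, of n] by (metis order.refl le_trans power2_eq_square)
  then have "m \<le> n" by (simp add: power2_nat_le_eq_le)
  then have "{k \<in> {1..n}. k\<^sup>2 \<le> j * n} = {1..m}"
    using le_m by (auto simp flip: le_m)
  then show ?thesis by (simp add: m_def)
qed

text \<open>Consecutive signs are opposite, so twice a term is its difference from the preceding
  one, and the sum telescopes.\<close>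

lemma alternating_sum_Icc:
  assumes "m \<le> n"
  shows "2 * (\<Sum>j=m..n. (-1) ^ (j + 1)) = ((-1) ^ (n + 1) + (-1) ^ (m + 1) :: int)"
  using assms by (induction n rule: dec_induct) simp_all

theorem theorem1p1:
  fixes n :: nat
  assumes "n \<ge> 1" and "odd n"
  shows "real_of_int (\<Sum>j=1..n. (-1) ^ (j + 1) * \<lfloor>sqrt (real j * real n)\<rfloor>) = (real n + 1) / 2"
proof -
  define c where "c = ceil_sq_div n"
  define S where "S = (\<Sum>j=1..n. (-1) ^ (j + 1) * \<lfloor>sqrt (real j * real n)\<rfloor>)"
  \<comment> \<open>The index \<open>n\<close> is left out so that \<open>k \<mapsto> n - k\<close>
    permutes the range.\<close>
  define T :: int where "T = (\<Sum>k=1..n-1. (-1) ^ c k)"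
  have c_le: "c k \<le> j \<longleftrightarrow> k\<^sup>2 \<le> j * n" for j k
    using assms(1) by (simp add: c_def ceil_sq_div_le_iff)
  have "S = (\<Sum>j=1..n. \<Sum>k=1..n. if c k \<le> j then (-1) ^ (j + 1) else 0)"
    unfolding S_def
    by (intro sum.cong refl) (simp add: floor_sqrt_mult_eq_card c_le flip: sum.inter_filter)
  also have "\<dots> = (\<Sum>k=1..n. \<Sum>j=1..n. if c k \<le> j then (-1) ^ (j + 1) else 0)"
    by (rule sum.swap)
  also have "2 * \<dots> = (\<Sum>k=1..n. 1 - (-1) ^ c k)"
  proof (subst sum_distrib_left, intro sum.cong refl)
    fix k assume k: "k \<in> {1..n}"
    have "c k \<le> n"
      using k by (simp add: c_le power2_eq_square mult_le_mono)
    moreover have "c k \<ge> 1"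
      using c_le[of k 0] k by (simp add: not_le Suc_le_eq)
    ultimately have "{j \<in> {1..n}. c k \<le> j} = {c k..n}" by auto
    then have "(\<Sum>j=1..n. if c k \<le> j then (-1) ^ (j + 1) else 0) = (\<Sum>j=c k..n. (-1) ^ (j + 1) :: int)"
      by (simp flip: sum.inter_filter)
    then show "2 * (\<Sum>j=1..n. if c k \<le> j then (-1) ^ (j + 1) else 0) = (1 - (-1) ^ c k :: int)"
      using alternating_sum_Icc[OF \<open>c k \<le> n\<close>] assms(2) by simp
  qed
  also have "\<dots> = int n - (\<Sum>k=1..n. (-1) ^ c k)"
    by (simp add: sum_subtractf)
  also have "(\<Sum>k=1..n. (-1) ^ c k) = T + (-1) ^ c n"
    using assms(1) by (cases n) (simp_all add: T_def)
  also have "c n = n"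
    using assms(1) by (simp add: c_def ceil_sq_div_self)
  finally have S: "2 * S = int n - (T + (-1) ^ n)" .
  have "T = (\<Sum>k=1..n-1. (-1) ^ c (n - k))"
    unfolding T_def using assms(1) by (subst sum.atLeastAtMost_rev) simp
  also have "\<dots> = (\<Sum>k=1..n-1. - ((-1) ^ c k))"
  proof (intro sum.cong refl)
    fix k assume "k \<in> {1..n-1}"
    then have "c (n - k) + 2 * k = n + c k"
      unfolding c_def by (intro ceil_sq_div_diff) auto
    then have "even (c (n - k)) \<longleftrightarrow> odd (c k)"
      using assms(2) by presburger
    then show "(-1) ^ c (n - k) = (- ((-1) ^ c k) :: int)"
      by (cases "even (c k)") simp_all
  qed
  also have "\<dots> = - T"
    by (simp add: T_def sum_negf)
  \<comment> \<open>\<open>T = - T\<close> forces \<open>T = 0\<close>, and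
    \<open>(-1) ^ n = -1\<close> supplies the \<open>+ 1\<close>.\<close>
  finally have "2 * S = int n + 1"
    using S assms(2) by simp
  then have "2 * real_of_int S = real n + 1"
    by linarith
  then show ?thesis
    by (simp add: S_def)
qed

end
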